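(* Let $(Q_t)_{t\in\mathcal T}$ be an indexed system of subsets of a ground set $U$ of size $n$, with $\mathcal T$ finite and equipped with a probability distribution $\mu$. Suppose that $|Q_t|\le q$ for every $t$, and let $d=\mathbb E_{t\sim\mu}|Q_t|$. Assume $d>0$, let $c>d$ be an integer, and set $k=n^{1/c}$. Then there exist $j\in\{1,\ldots,c\}$, a subfamily $D\subseteq\mathcal T$, a kernel $K\subseteq U$, and a scale $$B=\frac{n}{k^j}=n^{1-j/c}$$ such that $$\mu(D)\ge1-\frac dc,\qquad |K|\le B\le n^{1-1/c}.$$ Moreover, the indexed petal system $P_t=Q_t\setminus K$, $t\in D$, under the conditioned distribution $\mu_D$, is $\left(\frac{d}{\mu(D)B},k\right)$-ranked-spread.
   Context: For $D\subseteq\mathcal T$ with $\mu(D)>0$, $\mu_D$ denotes $\mu$ conditioned on $D$. An indexed set system $(P_t)_{t\in D}$ with probability distribution $\nu$ on $D$ is $(m,k)$-ranked-spread (for $m,k>0$) if every nonempty $P_t$ admits an ordering $P_t=\{x_1(t),\ldots,x_{|P_t|}(t)\}$ such that, for every $i\in\{1,\dots,|P_t|\}$, $\nu(\{s\in D: x_i(t)\in P_s\})\le m k^{-i}$. The ordering may depend on $t$. *)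

theory Defs
  imports "HOL-Probability.Probability"
begin

(* The distribution on the index set D is a pmf supported in D.  The map x enumerates P t
   as x 1, ..., x (card (P t)); existence of the bijection forces a nonempty P t to be finite. *)
definition ranked_spread ::
    "real \<Rightarrow> real \<Rightarrow> 't set \<Rightarrow> 't pmf \<Rightarrow> ('t \<Rightarrow> 'a set) \<Rightarrow> bool" where
  "ranked_spread m k D \<nu> P \<longleftrightarrow>
     m > 0 \<and> k > 0 \<and> set_pmf \<nu> \<subseteq> D \<and>
     (\<forall>t\<in>D. P t \<noteq> {} \<longrightarrow>
        (\<exists>x. bij_betw x {1..card (P t)} (P t) \<and>
             (\<forall>i\<in>{1..card (P t)}.
                measure_pmf.prob \<nu> {s \<in> D. x i \<in> P s} \<le> m * k powr (- real i))))"

end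

theory Submission
  imports Defs
begin

text \<open>
  Let w u be the probability that u lies in a random set, and let the threshold at level l be
  d k^l / n. Call a level j bad for t if for some i > 0 at least i elements of Q t have weight
  between the thresholds of the levels j - i and j. By a ballot-type argument at most
  card (Q t) of the levels 1, ..., c are bad for t, so on average over t at most d of them are, and
  some level j is bad with probability at most d / c. Take K to be the elements above the threshold
  of level j, whose number is bounded by Markov's inequality, and let D consist of the t for
  which j is not bad. Ordering Q t - K by decreasing weight, fewer than i of its elements exceed the
  threshold of level j - i, so the i-th one does not.
\<close>

text \<open>Linearity of expectation applied to indicators; finite support makes them integrable. It
  serves both for the total weight over \<open>U\<close> and for the expected number of bad
  levels.\<close>

lemma sum_prob_eq_expectation_card:
  fixes \<mu> :: "'t pmf"
  assumes "finite (set_pmf \<mu>)" "finite I"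
  shows "(\<Sum>i\<in>I. measure_pmf.prob \<mu> {t. R i t})
    = measure_pmf.expectation \<mu> (\<lambda>t. real (card {i \<in> I. R i t}))"
proof -
  have "measure_pmf.expectation \<mu> (\<lambda>t. real (card {i \<in> I. R i t}))
      = measure_pmf.expectation \<mu> (\<lambda>t. \<Sum>i\<in>I. indicator {t. R i t} t)"
    using assms(2) by (simp add: indicator_def sum.If_cases Int_def)
  also have "\<dots> = (\<Sum>i\<in>I. measure_pmf.expectation \<mu> (indicator {t. R i t}))"
    by (intro Bochner_Integration.integral_sum integrable_measure_pmf_finite assms)
  finally show ?thesis by simp
qed

lemma prob_cond_pmf:
  assumes "set_pmf \<mu> \<inter> D \<noteq> {}"
  shows "measure_pmf.prob (cond_pmf \<mu> D) A
    = measure_pmf.prob \<mu> (D \<inter> A) / measure_pmf.prob \<mu> D"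
proof -
  have "emeasure \<mu> D \<noteq> 0"
    using assms by (auto simp: measure_pmf.emeasure_eq_measure measure_pmf_zero_iff)
  then show ?thesis
    unfolding cond_pmf.rep_eq[OF assms]
    by (subst measure_uniform_measure) (auto simp: measure_pmf.emeasure_eq_measure)
qed

text \<open>
  The invariant: the running maximum of G l + l grows by one at every good level, because G is
  antitone, and stays the same at every bad one.
\<close>

lemma bad_levels_invariant:
  fixes G :: "int \<Rightarrow> nat"
  assumes "antimono G" and "\<And>l. G l \<le> N" and "l \<le> int c"
  shows "int (G l) + l + int (card {j \<in> {1..c}. \<exists>l<int j. int (G j) + int j \<le> int (G l) + l})
    \<le> int N + int c"
  using assms(3)
proof (induction c arbitrary: l)
  case 0
  then show ?case using assms(2)[of l] by simp
next
  case (Suc c)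
  let ?bad = "\<lambda>j::nat. \<exists>l<int j. int (G j) + int j \<le> int (G l) + l"
  have eq: "{j \<in> {1..Suc c}. ?bad j}
      = (if ?bad (Suc c) then insert (Suc c) {j \<in> {1..c}. ?bad j} else {j \<in> {1..c}. ?bad j})"
    by (auto simp: le_Suc_eq)
  show ?case
  proof (cases "?bad (Suc c)")
    case True
    then obtain l' where "l' < int (Suc c)"
      and l'_ge: "int (G (int (Suc c))) + int (Suc c) \<le> int (G l') + l'"
      by blast
    then have "l' \<le> int c" by simp
    note IH' = Suc.IH[OF this]
    have card: "card {j \<in> {1..Suc c}. ?bad j} = Suc (card {j \<in> {1..c}. ?bad j})"
      unfolding eq if_P[OF True] by (subst card_insert_disjoint) auto
    show ?thesis
    proof (cases "l = int (Suc c)")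
      case True
      \<comment> \<open>The earlier level \<open>l'\<close> already attains at least the value at
        \<open>Suc c\<close>, so the induction hypothesis at \<open>l'\<close> leaves room for one
        more bad level.\<close>
      show ?thesis unfolding card True using IH' l'_ge by linarith
    next
      case False
      then have "l \<le> int c" using Suc.prems by simp
      from Suc.IH[OF this] show ?thesis unfolding card by linarith
    qed
  next
    case False
    have card: "card {j \<in> {1..Suc c}. ?bad j} = card {j \<in> {1..c}. ?bad j}"
      unfolding eq if_not_P[OF False] ..
    show ?thesis
    proof (cases "l = int (Suc c)")
      case True
      have "G (int (Suc c)) \<le> G (int c)" using assms(1) by (simp add: antimonoD)
      with Suc.IH[of "int c"] show ?thesis unfolding card True by simp
    next
      case False
      then have "l \<le> int c" using Suc.prems by simp
      from Suc.IH[OF this] show ?thesis unfolding card by linarith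
    qed
  qed
qed

text \<open>Take \<open>l = int c\<close> in the invariant: the two occurrences of \<open>c\<close>
  cancel and \<open>G\<close> is nonnegative.\<close>

corollary card_bad_levels_le:
  fixes G :: "int \<Rightarrow> nat"
  assumes "antimono G" and "\<And>l. G l \<le> N"
  shows "card {j \<in> {1..c}. \<exists>l<int j. int (G j) + int j \<le> int (G l) + l} \<le> N"
  using bad_levels_invariant[OF assms, where c = c and l = "int c"] by simp

lemma finite_enumerate_decreasing:
  fixes w :: "'a \<Rightarrow> real"
  assumes "finite P"
  shows "\<exists>x. bij_betw x {1..card P} P
    \<and> (\<forall>i\<in>{1..card P}. \<forall>j\<in>{1..i}. w (x i) \<le> w (x j))"
proof -
  obtain ys where ys: "set ys = P" "distinct ys"
    using finite_distinct_list[OF assms] by blast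
  define xs where "xs = sort_key (\<lambda>u. - w u) ys"
  have xs: "set xs = P" "distinct xs" "length xs = card P"
    using ys distinct_card[OF ys(2)] by (simp_all add: xs_def)
  \<comment> \<open>List positions start at 0, the enumeration in \<open>ranked_spread\<close> at
    1.\<close>
  have "bij_betw (\<lambda>i. i - 1) {1..card P} {..<length xs}"
    using xs(3) by (intro bij_betw_byWitness[where f' = Suc]) auto
  then have "bij_betw ((!) xs \<circ> (\<lambda>i. i - 1)) {1..card P} P"
    using xs by (intro bij_betw_trans[OF _ bij_betw_nth]) auto
  moreover have "w (xs ! (i - 1)) \<le> w (xs ! (j - 1))" if "i \<in> {1..card P}" "j \<in> {1..i}" for i j
  proof -
    have "sorted (map (\<lambda>u. - w u) xs)" unfolding xs_def by simp
    then show ?thesis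
      using that xs(3) sorted_nth_mono[of "map (\<lambda>u. - w u) xs" "j - 1" "i - 1"] by auto
  qed
  ultimately show ?thesis by (intro exI[of _ "(!) xs \<circ> (\<lambda>i. i - 1)"]) simp
qed

text \<open>If \<open>x i\<close> exceeded \<theta>, so would the \<open>i\<close> distinct elements
  \<open>x 1\<close>, ..., \<open>x i\<close>.\<close>

lemma decreasing_enumeration_le:
  fixes w :: "'a \<Rightarrow> real"
  assumes "finite P" and "bij_betw x {1..card P} P"
    and "\<And>j. j \<in> {1..i} \<Longrightarrow> w (x i) \<le> w (x j)"
    and "i \<in> {1..card P}" and "card {u \<in> P. \<theta> < w u} < i"
  shows "w (x i) \<le> \<theta>"
proof (rule ccontr)
  assume "\<not> w (x i) \<le> \<theta>"
  then have "x ` {1..i} \<subseteq> {u \<in> P. \<theta> < w u}"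
    using assms(2-4) by (force simp: bij_betw_def)
  then have "card (x ` {1..i}) \<le> card {u \<in> P. \<theta> < w u}"
    using assms(1) by (intro card_mono) auto
  moreover have "inj_on x {1..i}"
    using assms(2,4) by (auto simp: bij_betw_def elim: inj_on_subset)
  ultimately show False using assms(5) by (simp add: card_image)
qed

theorem theorem4p2:
  fixes U :: "'a set" and T :: "'t set" and \<mu> :: "'t pmf" and Q :: "'t \<Rightarrow> 'a set"
    and n q c :: nat and d k :: real
  assumes "finite U" and "card U = n"
    and "finite T" and "set_pmf \<mu> \<subseteq> T"
    and "\<And>t. t \<in> T \<Longrightarrow> Q t \<subseteq> U"
    and "\<And>t. t \<in> T \<Longrightarrow> card (Q t) \<le> q"
    and "d = measure_pmf.expectation \<mu> (\<lambda>t. real (card (Q t)))"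
    and "d > 0" and "real c > d"
    and "k = real n powr (1 / real c)"
  shows "\<exists>j\<in>{1..c}. \<exists>D\<subseteq>T. \<exists>K\<subseteq>U. \<exists>B::real.
           B = real n / k ^ j \<and> B = real n powr (1 - real j / real c) \<and>
           measure_pmf.prob \<mu> D \<ge> 1 - d / real c \<and>
           real (card K) \<le> B \<and> B \<le> real n powr (1 - 1 / real c) \<and>
           ranked_spread (d / (measure_pmf.prob \<mu> D * B)) k D (cond_pmf \<mu> D) (\<lambda>t. Q t - K)"
proof -
  define w where "w u = measure_pmf.prob \<mu> {t. u \<in> Q t}" for u
  \<comment> \<open>Level 0 is the average weight \<open>d / n\<close>. Levels are integers because
    \<open>j - i\<close> may be negative.\<close>
  define \<theta> where "\<theta> l = d * k powr (real_of_int l) / real n" for l :: int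
  define G where "G t l = card {u \<in> Q t. \<theta> l < w u}" for t and l :: int
  \<comment> \<open>With \<open>l = j - i\<close> this says
    \<open>G t (j - i) - G t j \<ge> i\<close>, in the form required by
    \<open>card_bad_levels_le\<close>.\<close>
  define bad where "bad j t \<longleftrightarrow> (\<exists>l<int j. int (G t j) + int j \<le> int (G t l) + l)"
    for j :: nat and t
  have finT: "finite (set_pmf \<mu>)" using assms(3,4) finite_subset by blast
  have finQ: "finite (Q t)" if "t \<in> T" for t using assms(1,5) that finite_subset by blast
  have c: "c > 0" using assms(8,9) by (cases c) auto
  have sum_w: "(\<Sum>u\<in>U. w u) = d"
  proof -
    have "(\<Sum>u\<in>U. w u) = measure_pmf.expectation \<mu> (\<lambda>t. real (card {u \<in> U. u \<in> Q t}))"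
      unfolding w_def by (rule sum_prob_eq_expectation_card[OF finT assms(1)])
    also have "\<dots> = d" unfolding assms(7)
    proof (rule integral_cong_AE)
      have "{u \<in> U. u \<in> Q t} = Q t" if "t \<in> set_pmf \<mu>" for t
        using assms(4,5) that by blast
      then show "AE t in \<mu>. real (card {u \<in> U. u \<in> Q t}) = real (card (Q t))"
        by (simp add: AE_measure_pmf_iff)
    qed simp_all
    finally show ?thesis .
  qed
  have n: "n > 0" using sum_w assms(1,2,8) by (cases "U = {}") (auto simp: card_gt_0_iff)
  have k: "k \<ge> 1" using n unfolding assms(10) by (intro ge_one_powr_ge_zero) auto

  have "antimono (G t)" if "t \<in> T" for t
  proof (rule antimonoI)
    fix l l' :: int assume "l \<le> l'"
    then have "\<theta> l \<le> \<theta> l'"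
      unfolding \<theta>_def using k assms(8)
      by (intro divide_right_mono mult_left_mono powr_mono) auto
    then show "G t l' \<le> G t l"
      unfolding G_def using finQ[OF that] by (intro card_mono) auto
  qed
  moreover have "G t l \<le> card (Q t)" if "t \<in> T" for t l
    unfolding G_def using finQ[OF that] by (intro card_mono) auto
  ultimately have card_bad: "card {j \<in> {1..c}. bad j t} \<le> card (Q t)" if "t \<in> T" for t
    unfolding bad_def using that by (intro card_bad_levels_le) auto
  have sum_bad: "(\<Sum>j=1..c. measure_pmf.prob \<mu> {t. bad j t}) \<le> d"
    unfolding sum_prob_eq_expectation_card[OF finT finite_atLeastAtMost] assms(7)
    using card_bad assms(4)
    by (intro integral_mono_AE integrable_measure_pmf_finite finT) (auto simp: AE_measure_pmf_iff)
  obtain j where j: "j \<in> {1..c}" and prob_bad: "measure_pmf.prob \<mu> {t. bad j t} \<le> d / real c"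
  proof -
    have "\<exists>j\<in>{1..c}. measure_pmf.prob \<mu> {t. bad j t} \<le> d / real c"
    proof (rule ccontr)
      \<comment> \<open>Averaging: \<open>c\<close> probabilities, each above \<open>d / c\<close>,
        would sum to more than \<open>d\<close>.\<close>
      assume "\<not> ?thesis"
      then have "(\<Sum>j=1..c. d / real c) < (\<Sum>j=1..c. measure_pmf.prob \<mu> {t. bad j t})"
        using c by (intro sum_strict_mono) (auto simp: not_le)
      with sum_bad c show False by simp
    qed
    then show ?thesis using that by blast
  qed

  define D where "D = {t \<in> T. \<not> bad j t}"
  define K where "K = {u \<in> U. \<theta> (int j) < w u}"
  define B where "B = real n / k ^ j"
  \<comment> \<open>Here \<open>k ^ j\<close> equals \<open>n powr (j / c)\<close>.\<close>
  have B_powr: "B = real n powr (1 - real j / real c)"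
    using n k by (simp add: B_def assms(10) powr_diff powr_powr flip: powr_realpow)
  have B_pos: "B > 0" using n k by (simp add: B_def)
  \<comment> \<open>The threshold \<open>i\<close> levels below \<open>j\<close> is the desired
    spread bound, up to the factor \<open>1 / \<mu>(D)\<close> from conditioning.\<close>
  have \<theta>_eq: "\<theta> (int j - int i) = d / B * k powr (- real i)" for i
    using k by (simp add: \<theta>_def B_def powr_diff powr_minus_divide powr_realpow)

  have prob_D: "1 - d / real c \<le> measure_pmf.prob \<mu> D"
  proof -
    \<comment> \<open>The two sets differ only outside \<open>T\<close>, where \<mu> has no
      mass.\<close>
    have "measure_pmf.prob \<mu> D = measure_pmf.prob \<mu> (- {t. bad j t})"
      using assms(4) by (intro measure_prob_cong_0) (auto simp: D_def pmf_eq_0_set_pmf)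
    also have "\<dots> = 1 - measure_pmf.prob \<mu> {t. bad j t}"
      using measure_pmf.prob_compl[of "{t. bad j t}" \<mu>] by (simp add: Compl_eq_Diff_UNIV)
    finally show ?thesis using prob_bad by simp
  qed
  then have prob_D_pos: "measure_pmf.prob \<mu> D > 0"
    using assms(8,9) by (smt (verit) divide_less_eq_1)
  then have D_ne: "set_pmf \<mu> \<inter> D \<noteq> {}" by (metis measure_pmf_zero_iff less_irrefl)

  have card_K: "real (card K) \<le> B"
  proof -
    \<comment> \<open>Markov's inequality: elements of \<open>K\<close> weigh more than
      \<open>\<theta> j = d / B\<close>, and the total weight is \<open>d\<close>.\<close>
    have "real (card K) * \<theta> (int j) \<le> (\<Sum>u\<in>K. w u)"
      using sum_bounded_below[of K "\<theta> (int j)" w] by (force simp: K_def)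
    also have "\<dots> \<le> d"
      unfolding sum_w[symmetric] using assms(1)
      by (intro sum_mono2) (auto simp: K_def w_def)
    finally have "real (card K) * d \<le> B * d"
      using \<theta>_eq[of 0] B_pos k by (simp add: pos_divide_le_eq mult.commute)
    then show ?thesis using assms(8) by simp
  qed

  have spread: "\<exists>x. bij_betw x {1..card (Q t - K)} (Q t - K) \<and>
      (\<forall>i\<in>{1..card (Q t - K)}. measure_pmf.prob (cond_pmf \<mu> D) {s \<in> D. x i \<in> Q s - K}
         \<le> d / (measure_pmf.prob \<mu> D * B) * k powr (- real i))" if t: "t \<in> D" for t
  proof -
    have tT: "t \<in> T" and good: "\<And>l. l < int j \<Longrightarrow> int (G t l) + l < int (G t j) + int j"
      using t by (force simp: D_def bad_def)+
    have fin: "finite (Q t - K)" using finQ[OF tT] by simp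
    obtain x where x: "bij_betw x {1..card (Q t - K)} (Q t - K)"
      and dec: "\<And>i j. i \<in> {1..card (Q t - K)} \<Longrightarrow> j \<in> {1..i} \<Longrightarrow> w (x i) \<le> w (x j)"
      using finite_enumerate_decreasing[OF fin, of w] by blast
    have "measure_pmf.prob (cond_pmf \<mu> D) {s \<in> D. x i \<in> Q s - K}
         \<le> d / (measure_pmf.prob \<mu> D * B) * k powr (- real i)"
      if i: "i \<in> {1..card (Q t - K)}" for i
    proof -
      let ?l = "int j - int i"
      have "\<theta> ?l \<le> \<theta> (int j)"
        unfolding \<theta>_def using k assms(8)
        by (intro divide_right_mono mult_left_mono powr_mono) auto
      \<comment> \<open>Elements of \<open>Q t\<close> above the lower threshold are either petal
        elements or lie in \<open>K\<close>, and \<open>Q t \<inter> K\<close> has size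
        \<open>G t j\<close>. Since \<open>j\<close> is good for \<open>t\<close>, fewer than
        \<open>i\<close> petal elements remain.\<close>
      then have "{u \<in> Q t. \<theta> ?l < w u}
          = {u \<in> Q t - K. \<theta> ?l < w u} \<union> {u \<in> Q t. \<theta> (int j) < w u}"
        using assms(5)[OF tT] by (auto simp: K_def)
      moreover have "card ({u \<in> Q t - K. \<theta> ?l < w u} \<union> {u \<in> Q t. \<theta> (int j) < w u})
          = card {u \<in> Q t - K. \<theta> ?l < w u} + card {u \<in> Q t. \<theta> (int j) < w u}"
        using finQ[OF tT] assms(5)[OF tT] by (intro card_Un_disjoint) (auto simp: K_def)
      ultimately have "G t ?l = card {u \<in> Q t - K. \<theta> ?l < w u} + G t (int j)"
        unfolding G_def by simp
      then have "card {u \<in> Q t - K. \<theta> ?l < w u} < i"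
        using good[of ?l] i by simp
      then have w_le: "w (x i) \<le> \<theta> ?l"
        using decreasing_enumeration_le[where w = w, OF fin x dec[OF i] i] by blast
      have "measure_pmf.prob (cond_pmf \<mu> D) {s \<in> D. x i \<in> Q s - K}
          = measure_pmf.prob \<mu> (D \<inter> {s \<in> D. x i \<in> Q s - K}) / measure_pmf.prob \<mu> D"
        by (rule prob_cond_pmf[OF D_ne])
      \<comment> \<open>Dropping the restriction to \<open>D\<close> in the numerator leaves the
        unconditioned weight.\<close>
      also have "\<dots> \<le> w (x i) / measure_pmf.prob \<mu> D"
        unfolding w_def
        by (intro divide_right_mono measure_pmf.finite_measure_mono) auto
      also have "\<dots> \<le> \<theta> ?l / measure_pmf.prob \<mu> D"
        using w_le by (intro divide_right_mono) auto
      also have "\<dots> = d / (measure_pmf.prob \<mu> D * B) * k powr (- real i)"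
        unfolding \<theta>_eq by simp
      finally show ?thesis .
    qed
    with x show ?thesis by blast
  qed
  have "ranked_spread (d / (measure_pmf.prob \<mu> D * B)) k D (cond_pmf \<mu> D) (\<lambda>t. Q t - K)"
    unfolding ranked_spread_def
    using spread prob_D_pos B_pos assms(8) k D_ne by (auto simp: set_cond_pmf)
  moreover have "B \<le> real n powr (1 - 1 / real c)"
    \<comment> \<open>This uses \<open>j \<ge> 1\<close> and \<open>n \<ge> 1\<close>.\<close>
    unfolding B_powr using n j by (intro powr_mono) (auto simp: divide_right_mono)
  moreover have "D \<subseteq> T" "K \<subseteq> U" by (auto simp: D_def K_def)
  ultimately show ?thesis using j B_def B_powr prob_D card_K by blast
qed

end
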